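(* Let $\rho:\mathbb{R}\to\mathbb{R}$ be a non-affine continuous function that is continuously differentiable at some point $c\in\mathbb{R}$ with $\rho'(c)\ne 0$, and for $h>0$ let $$\Phi_h(x)=hx+c,\qquad \Psi_h(y)=\frac{y-\rho(c)}{h\,\rho'(c)} .$$ Let $W\in\mathbb{R}^{N\times N}$ be invertible, let $1\le r\le N$ be an integer and let $L=\lceil N/r\rceil$. Then there exist a non-zero scalar $\alpha\in\mathbb{R}$ and matrices $U_l,V_l\in\mathbb{R}^{N\times r_l}$ with $r_l\le r$, $l=1,\dots,L$, such that the matrices $M_l=\alpha I_N+U_lV_l^T$ satisfy $$W=M_LM_{L-1}\cdots M_1 .$$ Moreover, for any compact set $\mathcal{K}\subset\mathbb{R}^N$ and any $b\in\mathbb{R}^N$, $$\lim_{h\to 0}\ \rho\Big(M_L\circ\Psi_h\circ\rho\circ\Phi_h\circ M_{L-1}\circ\cdots\circ\Psi_h\circ\rho\circ\Phi_h\circ M_1(x)+b\Big)=\rho(Wx+b)\qquad\text{for all }x\in\mathcal{K}.$$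
   Context: $\rho,\Phi_h,\Psi_h$ are applied entrywise to vectors; each matrix $M_l$ is identified with the linear map $z\mapsto M_lz$ of $\mathbb{R}^N$. In the composition, the block $\Psi_h\circ\rho\circ\Phi_h$ is inserted between each pair of consecutive maps $M_{l}$ and $M_{l+1}$, $1\le l\le L-1$. "Continuously differentiable at $c$" means that $\rho$ is differentiable in a neighbourhood of $c$ and $\rho'$ is continuous at $c$. *)

theory Defs
  imports "HOL-Analysis.Analysis"
begin

definition entrywise :: "(real \<Rightarrow> real) \<Rightarrow> real ^ 'n \<Rightarrow> real ^ 'n"
  where "entrywise f x = (\<chi> i. f (x $ i))"

definition affine_fun :: "(real \<Rightarrow> real) \<Rightarrow> bool"
  where "affine_fun f \<longleftrightarrow> (\<exists>a b. \<forall>x. f x = a * x + b)"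

definition continuously_differentiable_at :: "(real \<Rightarrow> real) \<Rightarrow> real \<Rightarrow> bool"
  where "continuously_differentiable_at f c \<longleftrightarrow>
    (\<forall>\<^sub>F x in nhds c. f differentiable (at x)) \<and> isCont (deriv f) c"

definition Phi :: "real \<Rightarrow> real \<Rightarrow> real \<Rightarrow> real"
  where "Phi c h x = h * x + c"

definition Psi :: "(real \<Rightarrow> real) \<Rightarrow> real \<Rightarrow> real \<Rightarrow> real \<Rightarrow> real"
  where "Psi \<rho> c h y = (y - \<rho> c) / (h * deriv \<rho> c)"

text \<open>
  The inner dimension \<open>m\<close> has to vary under an existential quantifier, so it cannot be a type.
  A real matrix with rows indexed by \<open>'n\<close> and \<open>m\<close> columns is therefore represented by its entries
  \<open>U i k\<close> with \<open>k < m\<close>; values for \<open>k \<ge> m\<close> are ignored. The following is the product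
  of \<open>U\<close> with the transpose of \<open>V\<close>.
\<close>

definition mult_transpose ::
    "nat \<Rightarrow> ('n \<Rightarrow> nat \<Rightarrow> real) \<Rightarrow> ('n \<Rightarrow> nat \<Rightarrow> real) \<Rightarrow> real ^ 'n ^ 'n"
  where "mult_transpose m U V = (\<chi> i j. \<Sum>k<m. U i k * V j k)"

text \<open>Factors are indexed from 1, and later factors stand on the left.\<close>

primrec matrix_prod :: "(nat \<Rightarrow> real ^ 'n ^ 'n) \<Rightarrow> nat \<Rightarrow> real ^ 'n ^ 'n"
  where
    "matrix_prod M 0 = mat 1"
  | "matrix_prod M (Suc l) = M (Suc l) ** matrix_prod M l"

text \<open>\<open>interleave f s L\<close> is \<open>f L \<circ> s \<circ> f (L - 1) \<circ> \<dots> \<circ> s \<circ> f 1\<close>, so \<open>s\<close> occurs \<open>L - 1\<close> times.\<close>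

fun interleave :: "(nat \<Rightarrow> 'a \<Rightarrow> 'a) \<Rightarrow> ('a \<Rightarrow> 'a) \<Rightarrow> nat \<Rightarrow> 'a \<Rightarrow> 'a"
  where
    "interleave f s 0 = id"
  | "interleave f s (Suc 0) = f 1"
  | "interleave f s (Suc (Suc l)) = f (Suc (Suc l)) \<circ> s \<circ> interleave f s (Suc l)"

definition deep_net ::
    "(real \<Rightarrow> real) \<Rightarrow> real \<Rightarrow> (nat \<Rightarrow> real ^ 'n ^ 'n) \<Rightarrow> nat \<Rightarrow> real ^ 'n \<Rightarrow> real \<Rightarrow> real ^ 'n \<Rightarrow> real ^ 'n"
  where "deep_net \<rho> c M L b h x =
    entrywise \<rho>
      (interleave (\<lambda>l z. M l *v z)
         (entrywise (Psi \<rho> c h) \<circ> entrywise \<rho> \<circ> entrywise (Phi c h)) L x + b)"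

end

theory Submission
  imports Defs
begin

text \<open>
  The scalar can be taken to be 1. If an invertible matrix A moves a vector x, then A x is not a
  fixed vector either, so some v orthogonal to the fixed space of A has v \<bullet> x = 1 and
  v \<bullet> A x \<noteq> 0. The map E z = z + (v \<bullet> z) (A x - x) is then invertible, and inverse E \<circ> A fixes x in
  addition to everything that A fixes. Splitting off such factors N times leaves the identity; a
  product of r of them is I plus a matrix of rank at most r.

  For the limit, differentiability of \<rho> at c makes the inserted blocks converge to the identity
  uniformly on bounded sets, and this passes through the finite composition.
\<close>

section \<open>Enlarging the fixed space by rank-one factors\<close>

definition fixed_space :: "real ^ 'n ^ 'n \<Rightarrow> (real ^ 'n) set"
  where "fixed_space A = {x. A *v x = x}"

lemma subspace_fixed_space: "subspace (fixed_space A)"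
  by (auto simp: subspace_def fixed_space_def matrix_vector_right_distrib matrix_vector_mult_scaleR)

text \<open>Let p and q be the nonzero components of x and y orthogonal to F. If p and q are
  orthogonal, p + q pairs with x and y to p \<bullet> p and q \<bullet> q; otherwise p alone works,
  since it pairs with y to p \<bullet> q.\<close>

lemma exists_orthogonal_detecting_both:
  fixes F :: "'a::euclidean_space set"
  assumes "subspace F" "x \<notin> F" "y \<notin> F"
  obtains v where "\<And>z. z \<in> F \<Longrightarrow> v \<bullet> z = 0" "v \<bullet> x \<noteq> 0" "v \<bullet> y \<noteq> 0"
proof -
  have decomp: "\<exists>a p. a \<in> F \<and> (\<forall>z\<in>F. orthogonal p z) \<and> w = a + p" for w
    using orthogonal_subspace_decomp_exists[of F w] assms(1)
    by (metis span_eq_iff)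
  obtain a p where p: "a \<in> F" "\<And>z. z \<in> F \<Longrightarrow> p \<bullet> z = 0" "x = a + p"
    using decomp[of x] by (auto simp: orthogonal_def)
  obtain b q where q: "b \<in> F" "\<And>z. z \<in> F \<Longrightarrow> q \<bullet> z = 0" "y = b + q"
    using decomp[of y] by (auto simp: orthogonal_def)
  have nz: "p \<noteq> 0" "q \<noteq> 0"
    using assms p q by auto
  show thesis
  proof (cases "p \<bullet> q = 0")
    case True
    with p q nz show thesis
      by (intro that[of "p + q"]) (auto simp: inner_simps inner_commute[of q p])
  next
    case False
    with p q nz show thesis
      by (intro that[of p]) (auto simp: inner_simps)
  qed
qed

definition outer :: "real ^ 'n \<Rightarrow> real ^ 'n \<Rightarrow> real ^ 'n ^ 'n"
  where "outer u v = (\<chi> i j. u $ i * v $ j)"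

lemma outer_mult_vec: "outer u v *v x = (v \<bullet> x) *\<^sub>R u"
  by (simp add: outer_def matrix_vector_mult_def vec_eq_iff inner_vec_def sum_distrib_left
      mult_ac)

lemma matrix_mult_outer: "A ** outer u v = outer (A *v u) v"
  by (simp add: outer_def matrix_matrix_mult_def matrix_vector_mult_def vec_eq_iff
      sum_distrib_left mult_ac)

text \<open>Pairing the kernel equation with v leaves (v \<bullet> x) (1 + v \<bullet> u) = 0, so v
  \<bullet> x = 0, and the kernel equation then reads x = 0. The scalar 1 + v \<bullet> u is the
  determinant of the matrix.\<close>

lemma invertible_mat_1_plus_outer:
  assumes "1 + v \<bullet> u \<noteq> 0"
  shows "invertible (mat 1 + outer u v)"
proof -
  have "inj ((*v) (mat 1 + outer u v))"
  proof (subst linear_injective_0, safe)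
    fix x assume "(mat 1 + outer u v) *v x = 0"
    then have x: "x + (v \<bullet> x) *\<^sub>R u = 0"
      by (simp add: matrix_vector_mult_add_rdistrib outer_mult_vec)
    then have "v \<bullet> (x + (v \<bullet> x) *\<^sub>R u) = 0"
      by (simp only: inner_zero_right)
    then have "(v \<bullet> x) * (1 + v \<bullet> u) = 0"
      by (simp add: inner_simps algebra_simps)
    with assms x show "x = 0"
      by simp
  qed auto
  then show ?thesis
    by (simp add: invertible_left_inverse matrix_left_invertible_injective)
qed

lemma split_off_rank_one:
  fixes A :: "real ^ 'n ^ 'n"
  assumes "invertible A"
  obtains u v A' where "A = (mat 1 + outer u v) ** A'" "invertible A'"
    "min (CARD('n)) (Suc (dim (fixed_space A))) \<le> dim (fixed_space A')"
proof (cases "fixed_space A = UNIV")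
  case True
  \<comment> \<open>Nothing is left to gain once everything is fixed, so the factor is trivial. This
    case is the reason for \<open>min\<close> in the bound.\<close>
  have "A = (mat 1 + outer 0 0) ** A"
    by (simp add: outer_def zero_vec_def[symmetric])
  with assms True that show thesis
    by (metis dim_UNIV DIM_cart DIM_real mult.right_neutral min.cobounded1)
next
  case False
  let ?F = "fixed_space A"
  obtain x where x: "x \<notin> ?F"
    using False by auto
  have Ax: "A *v x \<notin> ?F"
  proof
    assume "A *v x \<in> ?F"
    then have "A *v (A *v x) = A *v x"
      by (simp add: fixed_space_def)
    moreover have "inj ((*v) A)"
      using assms by (simp add: inj_matrix_vector_mult)
    ultimately show False
      using x by (auto simp: fixed_space_def dest: injD)
  qed
  obtain w where w: "\<And>z. z \<in> ?F \<Longrightarrow> w \<bullet> z = 0" "w \<bullet> x \<noteq> 0" "w \<bullet> (A *v x) \<noteq> 0"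
    using exists_orthogonal_detecting_both[OF subspace_fixed_space x Ax] by blast
  \<comment> \<open>This scaling gives v \<bullet> x = 1, so that E below sends x to x + (A x - x) =
    A x.\<close>
  define v where "v = w /\<^sub>R (w \<bullet> x)"
  have v: "\<And>z. z \<in> ?F \<Longrightarrow> v \<bullet> z = 0" "v \<bullet> x = 1" "v \<bullet> (A *v x) \<noteq> 0"
    using w by (auto simp: v_def)
  define u where "u = A *v x - x"
  define E where "E = mat 1 + outer u v"
  have E: "E *v z = z + (v \<bullet> z) *\<^sub>R u" for z
    by (simp add: E_def matrix_vector_mult_add_rdistrib outer_mult_vec)
  \<comment> \<open>Here 1 + v \<bullet> u = v \<bullet> A x, because v \<bullet> x = 1.\<close>
  have invE: "invertible E"
    unfolding E_def using v by (intro invertible_mat_1_plus_outer) (simp add: u_def inner_simps)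
  obtain E' where E': "E ** E' = mat 1" "E' ** E = mat 1"
    using invE by (auto simp: invertible_def)
  define A' where "A' = E' ** A"
  have A: "A = E ** A'"
    using E' by (simp add: A'_def matrix_mul_assoc)
  have inv': "invertible A'"
    unfolding A'_def using E' assms
    by (intro invertible_mult) (auto simp: invertible_def)
  \<comment> \<open>\<open>A'\<close> fixes every vector on which A and E agree. These include x,
    and all of \<open>?F\<close>, where v vanishes and both maps are the identity.\<close>
  have fixed: "z \<in> fixed_space A'" if "A *v z = E *v z" for z
    using that E'
    by (simp add: fixed_space_def A'_def flip: matrix_vector_mul_assoc)
       (simp add: matrix_vector_mul_assoc)
  have "x \<in> fixed_space A'"
    using v by (intro fixed) (simp add: E u_def)
  moreover have "z \<in> fixed_space A'" if "z \<in> ?F" for z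
    using v(1)[OF that] that by (intro fixed) (simp add: E fixed_space_def)
  ultimately have "insert x ?F \<subseteq> fixed_space A'"
    by blast
  then have "dim (insert x ?F) \<le> dim (fixed_space A')"
    by (rule dim_subset)
  moreover have "dim (insert x ?F) = Suc (dim ?F)"
    using x by (simp add: dim_insert span_eq_iff[THEN iffD2, OF subspace_fixed_space])
  ultimately show thesis
    using that A inv' unfolding E_def by simp
qed

text \<open>Induction on m: with P = I + U V^T, the product P (I + u v^T) equals P + (P u) v^T, so
  one more rank-one factor costs one more column.\<close>

lemma split_off_low_rank:
  fixes A :: "real ^ 'n ^ 'n"
  assumes "invertible A"
  shows "\<exists>U V A'. A = (mat 1 + mult_transpose m U V) ** A' \<and> invertible A' \<and>
    min (CARD('n)) (dim (fixed_space A) + m) \<le> dim (fixed_space A')"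
proof (induction m)
  case 0
  have "mult_transpose 0 U V = (0 :: real ^ 'n ^ 'n)" for U V
    by (simp add: mult_transpose_def zero_vec_def)
  with assms show ?case
    by (intro exI[of _ "\<lambda>_ _. 0"] exI[of _ A]) simp
next
  case (Suc m)
  then obtain U V A' where IH: "A = (mat 1 + mult_transpose m U V) ** A'" "invertible A'"
    "min (CARD('n)) (dim (fixed_space A) + m) \<le> dim (fixed_space A')"
    by blast
  obtain u v A'' where A': "A' = (mat 1 + outer u v) ** A''" "invertible A''"
    "min (CARD('n)) (Suc (dim (fixed_space A'))) \<le> dim (fixed_space A'')"
    using split_off_rank_one[OF IH(2)] by blast
  define P where "P = mat 1 + mult_transpose m U V"
  \<comment> \<open>The new column, at index m, is P u rather than u, since the rank-one factor
    stands to the right of P.\<close>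
  define U' where "U' = (\<lambda>i k. if k < m then U i k else (P *v u) $ i)"
  define V' where "V' = (\<lambda>i k. if k < m then V i k else v $ i)"
  have "mult_transpose (Suc m) U' V' = mult_transpose m U V + outer (P *v u) v"
    by (simp add: mult_transpose_def outer_def vec_eq_iff U'_def V'_def)
  moreover have "P ** (mat 1 + outer u v) = P + outer (P *v u) v"
    by (simp add: matrix_add_ldistrib matrix_mult_outer)
  ultimately have "A = (mat 1 + mult_transpose (Suc m) U' V') ** A''"
    using IH(1) A'(1) by (simp add: P_def matrix_mul_assoc add.assoc)
  moreover have "min (CARD('n)) (dim (fixed_space A) + Suc m) \<le> dim (fixed_space A'')"
    using IH(3) A'(3) by linarith
  ultimately show ?case
    using A'(2) by blast
qed

lemma matrix_prod_cong:
  "(\<And>l. l \<in> {1..L} \<Longrightarrow> M l = M' l) \<Longrightarrow> matrix_prod M L = matrix_prod M' L"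
  by (induction L) auto

text \<open>The second hypothesis is a budget: each remaining factor can add r dimensions to the
  fixed space until it is the whole space. A changes along the induction, hence
  \<open>arbitrary\<close>.\<close>

lemma low_rank_factorization:
  fixes A :: "real ^ 'n ^ 'n"
  assumes "invertible A" "CARD('n) \<le> dim (fixed_space A) + L * r"
  shows "\<exists>U V. A = matrix_prod (\<lambda>l. mat 1 + mult_transpose r (U l) (V l)) L"
  using assms
proof (induction L arbitrary: A)
  case 0
  then have "dim (fixed_space A) = DIM(real ^ 'n)"
    using dim_subset_UNIV[of "fixed_space A"] by simp
  then have "fixed_space A = UNIV"
    using subspace_fixed_space[of A] by (metis dim_eq_full span_eq_iff)
  then have "A = mat 1"
    by (auto simp: fixed_space_def matrix_eq)
  then show ?case
    by simp
next
  case (Suc L)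
  obtain U V A' where A: "A = (mat 1 + mult_transpose r U V) ** A'" and "invertible A'"
    and "min (CARD('n)) (dim (fixed_space A) + r) \<le> dim (fixed_space A')"
    using split_off_low_rank[OF Suc.prems(1)] by blast
  moreover from this(3) have "CARD('n) \<le> dim (fixed_space A') + L * r"
    using Suc.prems(2) by simp
  ultimately obtain U' V' where
    A': "A' = matrix_prod (\<lambda>l. mat 1 + mult_transpose r (U' l) (V' l)) L"
    using Suc.IH by blast
  \<comment> \<open>The factor split off first is the leftmost one, so it gets the top index
    \<open>Suc L\<close>; the updates at that index leave the factors of \<open>A'\<close>
    unchanged.\<close>
  have "A' = matrix_prod
      (\<lambda>l. mat 1 + mult_transpose r ((U'(Suc L := U)) l) ((V'(Suc L := V)) l)) L"
    unfolding A' by (rule matrix_prod_cong) auto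
  with A have "A = matrix_prod
      (\<lambda>l. mat 1 + mult_transpose r ((U'(Suc L := U)) l) ((V'(Suc L := V)) l)) (Suc L)"
    by simp
  then show ?case
    by blast
qed

section \<open>Uniform convergence of the network\<close>

lemma uniform_limit_compose_bounded:
  fixes f' :: "'a::euclidean_space \<Rightarrow> 'b::metric_space"
  assumes f: "\<And>B. uniform_limit (cball 0 B) f f' F" and "continuous_on UNIV f'"
    and g: "uniform_limit K g g' F" and "bounded (g' ` K)"
  shows "uniform_limit K (\<lambda>h x. f h (g h x)) (\<lambda>x. f' (g' x)) F"
proof (rule uniform_limitI)
  fix e :: real assume "e > 0"
  obtain B where B: "\<And>x. x \<in> K \<Longrightarrow> norm (g' x) \<le> B"
    using assms(4) by (auto simp: bounded_iff)
  \<comment> \<open>The extra 1 in the radius leaves room for \<open>g h x\<close>, which is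
    eventually within 1 of \<open>g' x\<close>. On this compact ball f' is uniformly continuous and
    f h is uniformly close to f'.\<close>
  have "uniformly_continuous_on (cball 0 (B + 1)) f'"
    using assms(2) by (intro compact_uniformly_continuous) (auto intro: continuous_on_subset)
  then obtain d where d: "d > 0" "\<And>y z. y \<in> cball 0 (B + 1) \<Longrightarrow> z \<in> cball 0 (B + 1) \<Longrightarrow>
      dist z y < d \<Longrightarrow> dist (f' z) (f' y) < e / 2"
    using \<open>e > 0\<close> unfolding uniformly_continuous_on_def by (metis half_gt_zero)
  have "\<forall>\<^sub>F h in F. \<forall>x\<in>cball 0 (B + 1). dist (f h x) (f' x) < e / 2"
    using f \<open>e > 0\<close> by (intro uniform_limitD) auto
  moreover have "\<forall>\<^sub>F h in F. \<forall>x\<in>K. dist (g h x) (g' x) < min d 1"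
    using g \<open>d > 0\<close> by (intro uniform_limitD) auto
  ultimately show "\<forall>\<^sub>F h in F. \<forall>x\<in>K. dist (f h (g h x)) (f' (g' x)) < e"
  proof eventually_elim
    case (elim h)
    show ?case
    proof
      fix x assume x: "x \<in> K"
      have dg: "dist (g h x) (g' x) < d" "dist (g h x) (g' x) < 1"
        using elim(2) x by auto
      have "norm (g h x) \<le> norm (g' x) + dist (g h x) (g' x)"
        unfolding dist_norm by norm
      then have mem: "g h x \<in> cball 0 (B + 1)" "g' x \<in> cball 0 (B + 1)"
        using B[OF x] dg by auto
      have "dist (f h (g h x)) (f' (g h x)) < e / 2"
        using elim(1) mem by blast
      moreover have "dist (f' (g h x)) (f' (g' x)) < e / 2"
        using d(2) mem dg by blast
      ultimately show "dist (f h (g h x)) (f' (g' x)) < e"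
        using dist_triangle[of "f h (g h x)" "f' (g' x)" "f' (g h x)"] by linarith
    qed
  qed
qed

lemma continuous_on_entrywise:
  fixes f :: "real \<Rightarrow> real"
  assumes "continuous_on UNIV f"
  shows "continuous_on UNIV (entrywise f :: real ^ 'n \<Rightarrow> real ^ 'n)"
  unfolding entrywise_def
  by (intro continuous_on_vec_lambda continuous_on_compose2[OF assms] continuous_intros) auto

text \<open>In each coordinate t, the block differs from the identity by the first-order Taylor
  remainder of \<rho> at c for the increment h t, divided by h \<rho>'(c). The remainder is o(h)
  uniformly for bounded t.\<close>

lemma uniform_limit_activation_block:
  fixes \<rho> :: "real \<Rightarrow> real"
  assumes "\<rho> differentiable (at c)" "deriv \<rho> c \<noteq> 0"
  shows "uniform_limit (cball 0 B)
    (\<lambda>h. entrywise (Psi \<rho> c h) \<circ> entrywise \<rho> \<circ> entrywise (Phi c h))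
    (\<lambda>x :: real ^ 'n. x) (at_right 0)"
proof (rule uniform_limitI)
  fix e :: real assume "e > 0"
  define D where "D = deriv \<rho> c"
  have "(\<rho> has_field_derivative D) (at c)"
    using assms(1) by (simp add: D_def DERIV_deriv_iff_real_differentiable)
  then have der: "(\<rho> has_derivative (*) D) (at c)"
    by (simp add: has_field_derivative_def)
  define N where "N = real CARD('n)"
  \<comment> \<open>This bound is positive for every real B, which allows division by it.\<close>
  define B' where "B' = \<bar>B\<bar> + 1"
  have pos: "B' > 0" "\<bar>D\<bar> > 0" "N > 0"
    using assms(2) by (auto simp: D_def B'_def N_def)
  \<comment> \<open>Chosen so that \<epsilon> h B' / (h |D|) = e / (2 N); the l1 bound on the norm
    then adds N such errors to e / 2.\<close>
  define \<epsilon> where "\<epsilon> = e * \<bar>D\<bar> / (2 * N * B')"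
  have "\<epsilon> > 0"
    using pos \<open>e > 0\<close> by (simp add: \<epsilon>_def)
  then obtain d where d: "d > 0" "\<And>y. \<bar>y - c\<bar> < d \<Longrightarrow> \<bar>\<rho> y - \<rho> c - D * (y - c)\<bar> \<le> \<epsilon> * \<bar>y - c\<bar>"
    using der unfolding has_derivative_at_alt by (metis real_norm_def)
  have entry: "\<bar>Psi \<rho> c h (\<rho> (Phi c h t)) - t\<bar> \<le> e / (2 * N)"
    if "0 < h" "h < d / B'" "\<bar>t\<bar> \<le> B'" for h t
  proof -
    have "\<bar>h * t\<bar> \<le> h * B'"
      using that by (simp add: abs_mult)
    also have "\<dots> < d"
      using that pos by (simp add: field_simps)
    finally have "\<bar>\<rho> (h * t + c) - \<rho> c - D * (h * t)\<bar> \<le> \<epsilon> * \<bar>h * t\<bar>"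
      using d(2)[of "h * t + c"] by simp
    also have "\<dots> \<le> \<epsilon> * (h * B')"
      using \<open>\<bar>h * t\<bar> \<le> h * B'\<close> \<open>\<epsilon> > 0\<close> by (intro mult_left_mono) auto
    finally have "\<bar>\<rho> (h * t + c) - \<rho> c - D * (h * t)\<bar> / \<bar>h * D\<bar> \<le> \<epsilon> * (h * B') / \<bar>h * D\<bar>"
      by (rule divide_right_mono) simp
    moreover have "Psi \<rho> c h (\<rho> (Phi c h t)) - t = (\<rho> (h * t + c) - \<rho> c - D * (h * t)) / (h * D)"
      using that pos by (auto simp: Psi_def Phi_def D_def[symmetric] field_simps)
    moreover have "\<epsilon> * (h * B') / \<bar>h * D\<bar> = e / (2 * N)"
      using that pos by (simp add: \<epsilon>_def abs_mult field_simps)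
    ultimately show ?thesis
      by (simp add: abs_divide)
  qed
  have "\<forall>\<^sub>F h in at_right 0. h \<in> {0<..<d / B'}"
    using d pos by (intro eventually_at_right_real) simp
  then show "\<forall>\<^sub>F h in at_right 0. \<forall>x\<in>cball 0 B. dist
      ((entrywise (Psi \<rho> c h) \<circ> entrywise \<rho> \<circ> entrywise (Phi c h)) (x :: real ^ 'n)) x < e"
  proof eventually_elim
    case (elim h)
    show ?case
    proof
      fix x :: "real ^ 'n" assume "x \<in> cball 0 B"
      then have x: "\<bar>x $ i\<bar> \<le> B'" for i
        using component_le_norm_cart[of x i] by (simp add: B'_def)
      let ?y = "(entrywise (Psi \<rho> c h) \<circ> entrywise \<rho> \<circ> entrywise (Phi c h)) x"
      have "dist ?y x \<le> (\<Sum>i\<in>UNIV. \<bar>(?y - x) $ i\<bar>)"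
        unfolding dist_norm by (rule norm_le_l1_cart)
      also have "\<dots> \<le> (\<Sum>i\<in>(UNIV :: 'n set). e / (2 * N))"
        using entry x elim by (intro sum_mono) (simp add: entrywise_def)
      also have "\<dots> = e / 2"
        using pos by (simp add: N_def)
      finally show "dist ?y x < e"
        using \<open>e > 0\<close> by simp
    qed
  qed
qed

text \<open>The two base cases follow \<open>interleave\<close>, which inserts s only between
  factors. In the step, the limit map sends K to a bounded set, where s h tends uniformly to the
  identity.\<close>

lemma uniform_limit_interleave:
  fixes M :: "nat \<Rightarrow> real ^ 'n ^ 'n"
  assumes s: "\<And>B. uniform_limit (cball 0 B) s (\<lambda>x. x) F" and K: "bounded K"
  shows "uniform_limit K (\<lambda>h. interleave (\<lambda>l z. M l *v z) (s h) L) ((*v) (matrix_prod M L)) F"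
proof (induction L rule: induct_nat_012)
  case (ge2 l)
  have "bounded ((*v) (matrix_prod M (Suc l)) ` K)"
    using K by (intro bounded_linear_image matrix_vector_mul_bounded_linear)
  then have "uniform_limit K (\<lambda>h x. s h (interleave (\<lambda>l z. M l *v z) (s h) (Suc l) x))
      ((*v) (matrix_prod M (Suc l))) F"
    using uniform_limit_compose_bounded[OF s _ ge2(2)] by simp
  then have "uniform_limit K
      (\<lambda>h x. M (Suc (Suc l)) *v s h (interleave (\<lambda>l z. M l *v z) (s h) (Suc l) x))
      (\<lambda>x. M (Suc (Suc l)) *v (matrix_prod M (Suc l) *v x)) F"
    by (rule bounded_linear.uniform_limit[OF matrix_vector_mul_bounded_linear])
  then show ?case
    by (simp add: comp_def matrix_vector_mul_assoc)
qed (auto simp: uniform_limit_const id_def)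

lemma uniform_limit_deep_net:
  fixes M :: "nat \<Rightarrow> real ^ 'n ^ 'n"
  assumes "continuous_on UNIV \<rho>" "\<rho> differentiable (at c)" "deriv \<rho> c \<noteq> 0" "bounded K"
  shows "uniform_limit K (deep_net \<rho> c M L b)
    (\<lambda>x. entrywise \<rho> (matrix_prod M L *v x + b)) (at_right 0)"
proof -
  let ?s = "\<lambda>h. entrywise (Psi \<rho> c h) \<circ> entrywise \<rho> \<circ> entrywise (Phi c h)"
  have "uniform_limit K (\<lambda>h x. interleave (\<lambda>l z. M l *v z) (?s h) L x + b)
      (\<lambda>x. matrix_prod M L *v x + b) (at_right 0)"
    using assms
    by (intro uniform_limit_intros uniform_limit_interleave uniform_limit_activation_block)
  moreover have "bounded ((\<lambda>y. b + y) ` (*v) (matrix_prod M L) ` K)"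
    using assms(4)
    by (intro bounded_translation bounded_linear_image matrix_vector_mul_bounded_linear)
  then have "bounded ((\<lambda>x. matrix_prod M L *v x + b) ` K)"
    by (simp only: image_image add.commute[of b])
  \<comment> \<open>The outer activation is treated as a family constant in h.\<close>
  ultimately show ?thesis
    unfolding deep_net_def
    using uniform_limit_compose_bounded[OF uniform_limit_const continuous_on_entrywise[OF assms(1)]]
    by blast
qed

theorem theorem4:
  fixes \<rho> :: "real \<Rightarrow> real" and c :: real
    and W :: "real ^ 'n ^ 'n" and r L :: nat
  assumes "\<not> affine_fun \<rho>"
    and "continuous_on UNIV \<rho>"
    and "continuously_differentiable_at \<rho> c"
    and "deriv \<rho> c \<noteq> 0"
    and "invertible W"
    and "1 \<le> r" and "r \<le> CARD('n)"
    and "L = nat \<lceil>real CARD('n) / real r\<rceil>"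
  shows "\<exists>(\<alpha>::real) (R :: nat \<Rightarrow> nat) (U :: nat \<Rightarrow> 'n \<Rightarrow> nat \<Rightarrow> real)
      (V :: nat \<Rightarrow> 'n \<Rightarrow> nat \<Rightarrow> real) (M :: nat \<Rightarrow> real ^ 'n ^ 'n).
      \<alpha> \<noteq> 0 \<and>
      (\<forall>l\<in>{1..L}. R l \<le> r \<and> M l = \<alpha> *\<^sub>R mat 1 + mult_transpose (R l) (U l) (V l)) \<and>
      W = matrix_prod M L \<and>
      (\<forall>(K :: (real ^ 'n) set) b. compact K \<longrightarrow>
        (\<forall>x\<in>K. ((\<lambda>h. deep_net \<rho> c M L b h x) \<longlongrightarrow> entrywise \<rho> (W *v x + b)) (at_right 0)) \<and>
        uniform_limit K (deep_net \<rho> c M L b) (\<lambda>x. entrywise \<rho> (W *v x + b)) (at_right 0))"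
proof -
  \<comment> \<open>Rounding up gives L r \<ge> N, so the dimension budget suffices even if W fixes
    only 0.\<close>
  have "real CARD('n) / real r \<le> real L"
    unfolding \<open>L = _\<close> by linarith
  then have "real CARD('n) \<le> real (L * r)"
    using \<open>1 \<le> r\<close> by (simp add: field_simps)
  then have "CARD('n) \<le> dim (fixed_space W) + L * r"
    by linarith
  from low_rank_factorization[OF \<open>invertible W\<close> this] obtain U V where
    W: "W = matrix_prod (\<lambda>l. mat 1 + mult_transpose r (U l) (V l)) L"
    by blast
  let ?M = "\<lambda>l. mat 1 + mult_transpose r (U l) (V l)"
  have diff: "\<rho> differentiable (at c)"
    using assms(3) by (auto simp: continuously_differentiable_at_def dest: eventually_nhds_x_imp_x)
  have lim: "uniform_limit K (deep_net \<rho> c ?M L b) (\<lambda>x. entrywise \<rho> (W *v x + b)) (at_right 0)"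
    if "compact K" for K b
    unfolding W using assms diff that by (intro uniform_limit_deep_net compact_imp_bounded)
  show ?thesis
  \<comment> \<open>The witnesses are \<alpha> = 1 and inner dimension r for every factor; a factor
    of smaller rank is still written with r columns.\<close>
  proof (intro exI conjI ballI allI impI)
    show "(1::real) \<noteq> 0" "r \<le> r" "W = matrix_prod ?M L"
      using W by auto
    show "?M l = 1 *\<^sub>R mat 1 + mult_transpose r (U l) (V l)" for l
      by simp
  qed (auto intro: lim tendsto_uniform_limitI)
qed

end
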